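(* Let $V$ be a vertex algebra and let $\mathrm{gr}_{\mathcal{E}}(V)=\coprod_{n\ge 0}E_n/E_{n+1}$ be the associated differential algebra with derivation $\partial$ (defined in the context). Then $\mathrm{gr}_{\mathcal{E}}(V)$ is linearly spanned by the vectors $$\partial^{k_1}(v^{(1)}+E_1)\cdots\partial^{k_r}(v^{(r)}+E_1)$$ for $r\ge 1$, $v^{(1)},\dots,v^{(r)}\in V$, $k_1>\cdots>k_r\ge 0$. In particular, $\mathrm{gr}_{\mathcal{E}}(V)$ as a differential algebra is generated by the subspace $E_0/E_1$ $(=V/C_2(V))$.
   Context: Vector spaces are over $\mathbb{C}$. For a vertex algebra $V$ with vacuum $\mathbf{1}$ write $Y(u,x)=\sum_{n\in\mathbb{Z}}u_nx^{-n-1}$ and $\mathcal{D}v=v_{-2}\mathbf{1}$. For $n\in\mathbb{Z}$, $E_n=E_n(V)$ is the linear span of the vectors $u^{(1)}_{-1-k_1}\cdots u^{(r)}_{-1-k_r}v$ for $r\ge 1$, $u^{(1)},\dots,u^{(r)},v\in V$, $k_1,\dots,k_r\ge 0$ with $k_1+\cdots+k_r\ge n$; one has $E_0=V$. $C_2(V)$ is the linear span of the vectors $u_{-2}v$, $u,v\in V$; it equals $E_1(V)$. $\mathrm{gr}_{\mathcal{E}}(V)$ is a unital commutative associative $\mathbb{N}$-graded algebra with product $(a+E_{r+1})(b+E_{s+1})=a_{-1}b+E_{r+s+1}$ ($a\in E_r,b\in E_s$), identity $\mathbf{1}+E_1$, and derivation $\partial(u+E_{n+1})=\mathcal{D}u+E_{n+2}$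 ($u\in E_n$). A differential algebra is a unital commutative associative algebra with a derivation; generation as a differential algebra means generation under the algebra operations and $\partial$. *)

theory Defs
  imports Complex_Main "HOL-Algebra.Module" "HOL-Library.Set_Algebras" "HOL-Library.Groups_Big_Fun"
begin

section \<open>Differential algebras over the complex numbers\<close>

record 'b diff_algebra = "(complex, 'b) module" +
  deriv :: "'b \<Rightarrow> 'b"

definition lin_span :: "(complex, 'b, 'm) module_scheme \<Rightarrow> 'b set \<Rightarrow> 'b set" where
  "lin_span A S = {\<Oplus>\<^bsub>A\<^esub>x\<in>F. c x \<odot>\<^bsub>A\<^esub> x | c F. finite F \<and> F \<subseteq> S}"

inductive_set diff_generate :: "('b, 'm) diff_algebra_scheme \<Rightarrow> 'b set \<Rightarrow> 'b set"
  for A :: "('b, 'm) diff_algebra_scheme" and S :: "'b set" where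
  base: "x \<in> S \<Longrightarrow> x \<in> diff_generate A S"
| zero: "\<zero>\<^bsub>A\<^esub> \<in> diff_generate A S"
| one: "\<one>\<^bsub>A\<^esub> \<in> diff_generate A S"
| add: "x \<in> diff_generate A S \<Longrightarrow> y \<in> diff_generate A S \<Longrightarrow> x \<oplus>\<^bsub>A\<^esub> y \<in> diff_generate A S"
| smult: "x \<in> diff_generate A S \<Longrightarrow> c \<odot>\<^bsub>A\<^esub> x \<in> diff_generate A S"
| mult: "x \<in> diff_generate A S \<Longrightarrow> y \<in> diff_generate A S \<Longrightarrow> x \<otimes>\<^bsub>A\<^esub> y \<in> diff_generate A S"
| deriv: "x \<in> diff_generate A S \<Longrightarrow> deriv A x \<in> diff_generate A S"

section \<open>Vertex algebras\<close>

definition quot :: "'a::plus set \<Rightarrow> 'a set \<Rightarrow> 'a set set" where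
  "quot U W = (\<lambda>a. a +o W) ` U"

text \<open>
  Here \<open>nprod u n v\<close> is the vector $u_n v$, so that $Y(u,x)v = \sum_n u_n v\, x^{-n-1}$.
  The axiom \<open>jacobi\<close> is the coefficient form of the Jacobi identity
  $$x_0^{-1}\delta\left(\frac{x_1-x_2}{x_0}\right)Y(u,x_1)Y(v,x_2)w
    - x_0^{-1}\delta\left(\frac{x_2-x_1}{-x_0}\right)Y(v,x_2)Y(u,x_1)w
    = x_2^{-1}\delta\left(\frac{x_1-x_0}{x_2}\right)Y(Y(u,x_0)v,x_2)w,$$
  namely the coefficient of $x_0^{-l-1}x_1^{-m-1}x_2^{-n-1}$. By \<open>truncation\<close> all sums
  over \<open>i\<close> have finite support, as \<open>Sum_any\<close> requires.
\<close>

locale vertex_algebra = vector_space scale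
  for scale :: "complex \<Rightarrow> 'v::ab_group_add \<Rightarrow> 'v" +
  fixes nprod :: "'v \<Rightarrow> int \<Rightarrow> 'v \<Rightarrow> 'v" and vac :: 'v
  assumes linear_left: "Vector_Spaces.linear scale scale (\<lambda>u. nprod u n v)"
    and linear_right: "Vector_Spaces.linear scale scale (\<lambda>v. nprod u n v)"
    and truncation: "\<exists>N. \<forall>n\<ge>N. nprod u n v = 0"
    and vacuum: "nprod vac n v = (if n = -1 then v else 0)"
    and creation: "n \<ge> 0 \<Longrightarrow> nprod u n vac = 0" "nprod u (-1) vac = u"
    and jacobi:
      "Sum_any (\<lambda>i::nat. scale (of_int m gchoose i)
           (nprod (nprod u (l + int i) v) (m + n - int i) w)) =
       Sum_any (\<lambda>i::nat. scale ((-1) ^ i * (of_int l gchoose i))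
           (nprod u (m + l - int i) (nprod v (n + int i) w)
            - scale ((-1) powi l) (nprod v (n + l - int i) (nprod u (m + int i) w))))"
begin

definition D :: "'v \<Rightarrow> 'v" where
  "D v = nprod v (-2) vac"

text \<open>The list \<open>us\<close> consists of the pairs $(u^{(1)},k_1),\dots,(u^{(r)},k_r)$.\<close>

definition E :: "int \<Rightarrow> 'v set" where
  "E n = span {foldr (\<lambda>(u, k) w. nprod u (-1 - int k) w) us v | (us :: ('v \<times> nat) list) v.
                 us \<noteq> [] \<and> int (sum_list (map snd us)) \<ge> n}"

definition C2 :: "'v set" where
  "C2 = span {nprod u (-2) v | u v. True}"

text \<open>
  An element of the direct sum of the spaces $E_n/E_{n+1}$ is a sequence \<open>f\<close> of cosets
  \<open>f n \<in> quot (E n) (E (n + 1))\<close>, almost all of them equal to the zero coset \<open>E (n + 1)\<close>.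
  Addition of cosets and the sum over \<open>i\<close> in the product are the elementwise sums of sets
  from \<^theory>\<open>HOL-Library.Set_Algebras\<close>. As in \<open>rcoset_mult\<close>, the other
  operations are defined as the union of the cosets obtained from all representatives.
\<close>

definition gr :: "(nat \<Rightarrow> 'v set) diff_algebra" where
  "gr = \<lparr>carrier = {f. (\<forall>n. f n \<in> quot (E (int n)) (E (int n + 1))) \<and>
                        finite {n. f n \<noteq> E (int n + 1)}},
         mult = (\<lambda>f g n. \<Sum>i\<le>n. \<Union>a\<in>f i. \<Union>b\<in>g (n - i). nprod a (-1) b +o E (int n + 1)),
         one = (\<lambda>n. if n = 0 then vac +o E 1 else E (int n + 1)),
         zero = (\<lambda>n. E (int n + 1)),
         add = (\<lambda>f g n. f n + g n),
         smult = (\<lambda>c f n. \<Union>a\<in>f n. scale c a +o E (int n + 1)),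
         deriv = (\<lambda>f n. case n of 0 \<Rightarrow> E 1
                          | Suc m \<Rightarrow> \<Union>a\<in>f m. D a +o E (int m + 2))\<rparr>"

definition in_degree_0 :: "'v set \<Rightarrow> nat \<Rightarrow> 'v set" where
  "in_degree_0 X = (\<lambda>n. if n = 0 then X else E (int n + 1))"

text \<open>
  For \<open>kvs\<close> the list of pairs $(k_1,v^{(1)}),\dots,(k_r,v^{(r)})$ this is
  $\partial^{k_1}(v^{(1)}+E_1)\cdots\partial^{k_r}(v^{(r)}+E_1)$.
\<close>

definition gr_monomial :: "(nat \<times> 'v) list \<Rightarrow> nat \<Rightarrow> 'v set" where
  "gr_monomial kvs =
     foldr (\<lambda>(k, v) x. ((deriv gr) ^^ k) (in_degree_0 (v +o E 1)) \<otimes>\<^bsub>gr\<^esub> x) kvs \<one>\<^bsub>gr\<^esub>"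

end

end

theory Submission
  imports Defs "HOL-Library.Multiset"
begin

text \<open>
  The commutator and iterate formulas give $u_n E_s \subseteq E_{r+s-n-1}$ for $u \in E_r$, with
  one degree more when $n \ge 0$. Hence, modulo higher filtration, the product $a_{-1}b$ is
  associative, left multiplications commute, and $\mathcal{D}$ is a derivation; moreover
  $u_{-1-k}w = (\mathcal{D}^k u)_{-1}w / k!$, so the products $\partial^{k_1}v^{(1)}\cdots\partial^{k_r}v^{(r)}$
  span. A repeated order is removed by Leibniz' rule: $\binom{2k}{k}\,\partial^k a\,\partial^k b$ is
  $\partial^{2k}(ab)$ minus a combination of the products $\partial^i a\,\partial^{2k-i} b$ with
  $i \ne k$. All of these relations are congruences in $V$ modulo some $E_{n+1}$.
\<close>

section \<open>Auxiliary facts: finitely supported sums, binomials, linear spans and generated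
  differential algebras\<close>

lemma (in vector_space) subspace_Sum_any:
  assumes "subspace S" "\<And>i. f i \<in> S"
  shows "Sum_any f \<in> S"
  using assms by (auto simp: Sum_any.expand_set intro: subspace_sum)

lemma Sum_any_single:
  assumes "\<And>i. i \<noteq> j \<Longrightarrow> f i = 0"
  shows "Sum_any f = f j"
proof -
  have "{i. f i \<noteq> 0} \<subseteq> {j}"
    using assms by auto
  then have "Sum_any f = sum f {j}"
    by (intro Sum_any.expand_superset) auto
  then show ?thesis
    by simp
qed

lemma gbinomial_minus_one: "(- 1 gchoose i) = ((- 1) ^ i :: 'a::field_char_0)"
  using gbinomial_minus[of "1::'a" i] by (simp add: binomial_gbinomial[symmetric])

lemma gbinomial_minus_two: "(- 2 gchoose i) = ((- 1) ^ i * of_nat (Suc i) :: 'a::field_char_0)"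
proof -
  have "(2 + of_nat i - 1 :: 'a) = of_nat (Suc i)" by simp
  then show ?thesis
    using gbinomial_minus[of "2::'a" i]  by (simp only: binomial_gbinomial[symmetric] binomial_Suc_n)
qed

lemma gbinomial_0_eq: "(0 gchoose i) = (if i = 0 then 1 else 0 :: complex)"
  by (cases i) auto

lemma sum_list_mset_cong:
  assumes "mset xs = mset ys"
  shows "(\<Sum>x\<leftarrow>xs. f x :: nat) = (\<Sum>x\<leftarrow>ys. f x)"
  using assms by (metis mset_map sum_mset_sum_list)

text \<open>Bounds the sum of squares of the derivative orders by a quantity depending only on the
  weight, so a measure that subtracts it cannot fall below zero.\<close>

lemma sum_squares_le_square_sum: "(\<Sum>k\<leftarrow>ks. k\<^sup>2) \<le> (sum_list ks)\<^sup>2" for ks :: "nat list"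
  by (induction ks) (auto simp: power2_sum)

text \<open>Brings two factors with the same derivative order to the front. Equality of multisets is
  enough, because monomials may be permuted modulo higher filtration.\<close>

lemma not_distinct_map_fst_mset:
  assumes "\<not> distinct (map fst kvs)"
  obtains k a b rest where "mset kvs = mset ((k, a) # (k, b) # rest)"
proof -
  from not_distinct_decomp[OF assms] obtain xs ys zs k where "map fst kvs = xs @ [k] @ ys @ [k] @ zs"
    by blast
  then obtain xs' ys' zs' a b where "kvs = xs' @ (k, a) # ys' @ (k, b) # zs'"
    by (clarsimp simp: map_eq_append_conv map_eq_Cons_conv append_eq_map_conv Cons_eq_map_conv)
  then have "mset kvs = mset ((k, a) # (k, b) # xs' @ ys' @ zs')"
    by simp
  then show ?thesis by (rule that)
qed

lemma lin_span_zero: "\<zero>\<^bsub>A\<^esub> \<in> lin_span A S" if "abelian_monoid A"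
proof -
  interpret abelian_monoid A by fact
  show ?thesis
    by (auto simp: lin_span_def intro!: exI[of _ "{}"])
qed

lemma lin_span_smult:
  assumes "abelian_monoid A" "x \<in> S" "c \<odot>\<^bsub>A\<^esub> x \<in> carrier A"
  shows "c \<odot>\<^bsub>A\<^esub> x \<in> lin_span A S"
proof -
  interpret abelian_monoid A by fact
  have "c \<odot>\<^bsub>A\<^esub> x = (\<Oplus>\<^bsub>A\<^esub>x\<in>{x}. c \<odot>\<^bsub>A\<^esub> x)"
    using assms(3) by (subst finsum_insert) auto
  moreover have "finite {x}" "{x} \<subseteq> S"
    using assms(2) by auto
  ultimately show ?thesis
    unfolding lin_span_def by (intro CollectI exI[of _ "\<lambda>_. c"] exI[of _ "{x}"] conjI)
qed

text \<open>Both sums are extended to the union of their index sets with coefficient 0 and then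
  added termwise. The scalar laws are assumed on \<open>S\<close> alone, so the lemma applies before
  any module structure on \<open>A\<close> is established.\<close>

lemma lin_span_add:
  assumes "abelian_monoid A"
    and smult: "\<And>c x. x \<in> S \<Longrightarrow> c \<odot>\<^bsub>A\<^esub> x \<in> carrier A"
      "\<And>x. x \<in> S \<Longrightarrow> 0 \<odot>\<^bsub>A\<^esub> x = \<zero>\<^bsub>A\<^esub>"
      "\<And>c d x. x \<in> S \<Longrightarrow> (c + d) \<odot>\<^bsub>A\<^esub> x = c \<odot>\<^bsub>A\<^esub> x \<oplus>\<^bsub>A\<^esub> d \<odot>\<^bsub>A\<^esub> x"
    and "x \<in> lin_span A S" "y \<in> lin_span A S"
  shows "x \<oplus>\<^bsub>A\<^esub> y \<in> lin_span A S"
proof -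
  interpret abelian_monoid A by fact
  obtain c F where x: "x = (\<Oplus>\<^bsub>A\<^esub>z\<in>F. c z \<odot>\<^bsub>A\<^esub> z)" and F: "finite F" "F \<subseteq> S"
    using assms(5) by (auto simp: lin_span_def)
  obtain d G where y: "y = (\<Oplus>\<^bsub>A\<^esub>z\<in>G. d z \<odot>\<^bsub>A\<^esub> z)" and G: "finite G" "G \<subseteq> S"
    using assms(6) by (auto simp: lin_span_def)
  have extend: "(\<Oplus>\<^bsub>A\<^esub>z\<in>H. e z \<odot>\<^bsub>A\<^esub> z) =
      (\<Oplus>\<^bsub>A\<^esub>z\<in>F \<union> G. (if z \<in> H then e z else 0) \<odot>\<^bsub>A\<^esub> z)" if "H \<subseteq> F \<union> G" for H e
    using that F G smult by (intro add.finprod_mono_neutral_cong_left) auto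
  have "x \<oplus>\<^bsub>A\<^esub> y = (\<Oplus>\<^bsub>A\<^esub>z\<in>F \<union> G.
      (if z \<in> F then c z else 0) \<odot>\<^bsub>A\<^esub> z \<oplus>\<^bsub>A\<^esub> (if z \<in> G then d z else 0) \<odot>\<^bsub>A\<^esub> z)"
    unfolding x y by (subst (1 2) extend) (use F G smult in \<open>auto intro!: finsum_addf[symmetric]\<close>)
  also have "\<dots> = (\<Oplus>\<^bsub>A\<^esub>z\<in>F \<union> G.
      ((if z \<in> F then c z else 0) + (if z \<in> G then d z else 0)) \<odot>\<^bsub>A\<^esub> z)"
    using F G smult by (intro finsum_cong') auto
  finally show ?thesis
    unfolding lin_span_def using F G
    by (intro CollectI exI[of _ "\<lambda>z. (if z \<in> F then c z else 0) + (if z \<in> G then d z else 0)"]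
        exI[of _ "F \<union> G"]) auto
qed

lemma diff_generate_finsum:
  assumes "abelian_monoid A" "finite F" "\<And>x. x \<in> F \<Longrightarrow> f x \<in> diff_generate A S \<inter> carrier A"
  shows "(\<Oplus>\<^bsub>A\<^esub>x\<in>F. f x) \<in> diff_generate A S"
proof -
  interpret abelian_monoid A by fact
  show ?thesis
    using assms(2,3)
  proof (induction F)
    case (insert x F)
    then show ?case
      by (subst finsum_insert) (auto intro: diff_generate.add)
  qed (simp add: diff_generate.zero)
qed

lemma lin_span_subset_diff_generate:
  assumes "abelian_monoid A" "S \<subseteq> diff_generate A T"
    and "\<And>c x. x \<in> S \<Longrightarrow> c \<odot>\<^bsub>A\<^esub> x \<in> carrier A"
  shows "lin_span A S \<subseteq> diff_generate A T"
  unfolding lin_span_def using assms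
  by (auto intro!: diff_generate_finsum diff_generate.smult)

lemma diff_generate_subset_carrier:
  assumes "S \<subseteq> carrier A" "\<zero>\<^bsub>A\<^esub> \<in> carrier A" "\<one>\<^bsub>A\<^esub> \<in> carrier A"
    "\<And>x y. x \<in> carrier A \<Longrightarrow> y \<in> carrier A \<Longrightarrow> x \<oplus>\<^bsub>A\<^esub> y \<in> carrier A"
    "\<And>c x. x \<in> carrier A \<Longrightarrow> c \<odot>\<^bsub>A\<^esub> x \<in> carrier A"
    "\<And>x y. x \<in> carrier A \<Longrightarrow> y \<in> carrier A \<Longrightarrow> x \<otimes>\<^bsub>A\<^esub> y \<in> carrier A"
    "\<And>x. x \<in> carrier A \<Longrightarrow> deriv A x \<in> carrier A"
  shows "diff_generate A S \<subseteq> carrier A"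
proof
  fix x assume "x \<in> diff_generate A S"
  then show "x \<in> carrier A"
    by induction (use assms in auto)
qed

section \<open>The filtration of a vertex algebra\<close>

context vertex_algebra
begin

sublocale nprod_left: Vector_Spaces.linear scale scale "\<lambda>u. nprod u n v" for n v
  by (rule linear_left)

sublocale nprod_right: Vector_Spaces.linear scale scale "\<lambda>v. nprod u n v" for u n
  by (rule linear_right)

text \<open>The Jacobi identity at \<open>l = 0\<close>, where the coefficient binom(0, i) leaves
  only \<open>i = 0\<close> on the right.\<close>

lemma commutator_formula:
  "nprod u m (nprod v n w) - nprod v n (nprod u m w) =
     Sum_any (\<lambda>i::nat. scale (of_int m gchoose i) (nprod (nprod u (int i) v) (m + n - int i) w))"
  using jacobi[of m u 0 v n w]
  by (simp add: gbinomial_0_eq Sum_any_single[where j = 0])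

text \<open>The Jacobi identity at \<open>m = 0\<close>, where only \<open>i = 0\<close> survives on
  the left.\<close>

lemma iterate_formula:
  "nprod (nprod u l v) n w =
     Sum_any (\<lambda>i::nat. scale ((-1) ^ i * (of_int l gchoose i))
       (nprod u (l - int i) (nprod v (n + int i) w)
        - scale ((-1) powi l) (nprod v (n + l - int i) (nprod u (int i) w))))"
  using jacobi[of 0 u l v n w]
  by (simp add: gbinomial_0_eq Sum_any_single[where j = 0])

lemma subspace_E: "subspace (E n)"
  by (simp add: E_def)

lemma E_antimono: "m \<le> n \<Longrightarrow> E n \<subseteq> E m"
  unfolding E_def by (intro span_mono) auto

lemma nprod_in_E:
  assumes "x \<in> E s"
  shows "nprod u (-1 - int k) x \<in> E (s + int k)"
proof -
  let ?G = "\<lambda>s. {foldr (\<lambda>(u, k) w. nprod u (-1 - int k) w) us v | (us :: ('v \<times> nat) list) v.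
                 us \<noteq> [] \<and> int (sum_list (map snd us)) \<ge> s}"
  have "nprod u (-1 - int k) ` ?G s \<subseteq> ?G (s + int k)"
  proof safe
    fix us :: "('v \<times> nat) list" and v :: 'v
    assume "us \<noteq> []" "s \<le> int (sum_list (map snd us))"
    then show "\<exists>us' v'. nprod u (-1 - int k) (foldr (\<lambda>(u, k) w. nprod u (-1 - int k) w) us v) =
        foldr (\<lambda>(u, k) w. nprod u (-1 - int k) w) us' v' \<and> us' \<noteq> [] \<and> s + int k \<le> int (sum_list (map snd us'))"
      by (intro exI[of _ "(u, k) # us"] exI[of _ v]) auto
  qed
  then have "nprod u (-1 - int k) ` E s \<subseteq> E (s + int k)"
    unfolding E_def nprod_right.span_image[symmetric] by (rule span_mono)
  then show ?thesis
    using assms by blast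
qed

lemma E_nonpos: "n \<le> 0 \<Longrightarrow> E n = UNIV"
proof -
  assume "n \<le> 0"
  have "v \<in> E n" for v
    unfolding E_def using \<open>n \<le> 0\<close>
    \<comment> \<open>The list must be nonempty, so the identity operator vac_{-1} serves as its
      only mode.\<close>
    by (intro span_base CollectI exI[of _ "[(vac, 0)]"] exI[of _ v]) (auto simp: vacuum)
  then show ?thesis by auto
qed

text \<open>Words are built from the innermost vector outwards and tracked at their exact weight:
  \<open>nonpos\<close> starts at weight 0, \<open>step\<close> adds a mode, \<open>mono\<close>
  lowers the index to \<open>n\<close>, and \<open>subspace\<close> passes to the span.\<close>

lemma E_induct [consumes 1, case_names subspace nonpos step mono]:
  assumes x: "x \<in> E n"
    and subspace: "\<And>n. subspace {x. P n x}"
    and nonpos: "\<And>n x. n \<le> 0 \<Longrightarrow> P n x"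
    and step: "\<And>n u k x. x \<in> E n \<Longrightarrow> P n x \<Longrightarrow> P (n + int k) (nprod u (-1 - int k) x)"
    and mono: "\<And>m n x. m \<le> n \<Longrightarrow> P n x \<Longrightarrow> P m x"
  shows "P n x"
proof -
  let ?f = "\<lambda>us v. foldr (\<lambda>(u, k) w. nprod u (-1 - int k) w) us v"
  have foldr: "?f us v \<in> E (int (sum_list (map snd us))) \<and> P (int (sum_list (map snd us))) (?f us v)"
    for us v
  proof (induction us)
    case Nil
    then show ?case using nonpos E_nonpos by simp
  next
    case (Cons uk us)
    then show ?case
      using step nprod_in_E by (cases uk) (fastforce simp: add.commute)
  qed
  show ?thesis
    using x unfolding E_def
    by (rule span_induct) (use foldr mono subspace in blast)+
qed

lemma E_closed:
  shows E_zero: "0 \<in> E n"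
    and E_add: "x \<in> E n \<Longrightarrow> y \<in> E n \<Longrightarrow> x + y \<in> E n"
    and E_diff: "x \<in> E n \<Longrightarrow> y \<in> E n \<Longrightarrow> x - y \<in> E n"
    and E_scale: "x \<in> E n \<Longrightarrow> scale c x \<in> E n"
  using subspace_E by (auto intro: subspace_0 subspace_add subspace_diff subspace_scale)

lemma E_mono: "x \<in> E n \<Longrightarrow> m \<le> n \<Longrightarrow> x \<in> E m"
  using E_antimono by blast

text \<open>The operators \<open>nprod u n\<close> with \<open>n \<ge> 0\<close> gain one degree over the generic $-n-1$.\<close>

definition shift :: "int \<Rightarrow> int" where
  "shift n = (if n < 0 then - n - 1 else - n)"

lemma nprod_neg_in_E:
  assumes "x \<in> E s" "n < 0" "t \<le> s - n - 1"
  shows "nprod u n x \<in> E t"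
  using nprod_in_E[OF assms(1), of u "nat (- n - 1)"] assms(2,3) by (auto intro: E_mono)

text \<open>Induction on \<open>x\<close>, commuting u_n past the outermost mode v_{-1-k}. The
  commutator terms (u_i v)_{n-1-k-i} x vanish for \<open>i > n\<close>; otherwise a negative mode is
  bounded directly and a nonnegative one by the induction hypothesis, which holds for every left
  vector.\<close>

lemma nprod_nonneg_in_E:
  assumes "x \<in> E s"
  shows "nprod u (int n) x \<in> E (s - int n)"
  using assms
proof (induction arbitrary: u n rule: E_induct)
  case (subspace s)
  show ?case
    by (rule subspaceI)
       (auto simp: nprod_right.zero nprod_right.add nprod_right.scale intro: E_zero E_add E_scale)
next
  case (nonpos s x)
  then show ?case by (simp add: E_nonpos)
next
  case (step s v k x)
  let ?f = "\<lambda>i. scale (of_int (int n) gchoose i)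
    (nprod (nprod u (int i) v) (int n + (-1 - int k) - int i) x)"
  have "?f i \<in> E (s + int k - int n)" for i
  proof (cases "i \<le> n")
    case False
    then show ?thesis
      by (simp add: binomial_gbinomial[symmetric] binomial_eq_0 E_zero)
  next
    case True
    show ?thesis
    proof (cases "int n + (-1 - int k) - int i < 0")
      case True
      then show ?thesis by (auto intro!: E_scale nprod_neg_in_E[OF step.hyps])
    next
      case False
      then obtain j where j: "int n + (-1 - int k) - int i = int j"
        by (metis nonneg_int_cases not_less)
      show ?thesis
        unfolding j by (rule E_scale, rule E_mono[OF step.IH]) (use j in auto)
    qed
  qed
  then have "Sum_any ?f \<in> E (s + int k - int n)"
    by (intro subspace_Sum_any subspace_E)
  moreover have "nprod v (-1 - int k) (nprod u (int n) x) \<in> E (s + int k - int n)"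
    by (rule nprod_neg_in_E[OF step.IH]) auto
  ultimately have "Sum_any ?f + nprod v (-1 - int k) (nprod u (int n) x) \<in> E (s + int k - int n)"
    by (rule E_add)
  then show ?case
    unfolding commutator_formula[symmetric] by simp
next
  case (mono m n x)
  then show ?case by (meson E_mono diff_right_mono)
qed

lemma nprod_any_in_E:
  assumes "x \<in> E s" "t \<le> s + shift n"
  shows "nprod u n x \<in> E t"
proof (cases "n < 0")
  case True
  then show ?thesis using nprod_neg_in_E assms unfolding shift_def by auto
next
  case False
  then obtain j where "n = int j" by (metis nonneg_int_cases not_less)
  then show ?thesis
    using E_mono[OF nprod_nonneg_in_E[OF assms(1)], of t j u] assms(2) by (simp add: shift_def)
qed

text \<open>Induction on the left factor, expanding (u_{-1-k} x)_n y by the iterate formula. Both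
  kinds of terms have sufficient degree because \<open>shift\<close> has slope -1 except for the
  flat step from -1 to 0. The free bound \<open>t\<close> leaves only an integer inequality at each
  use.\<close>

lemma nprod_E_E:
  assumes "x \<in> E r" "y \<in> E s" "t \<le> r + s + shift n"
  shows "nprod x n y \<in> E t"
proof -
  have "nprod x n y \<in> E (r + s + shift n)"
    using assms(1,2)
  proof (induction arbitrary: y n s rule: E_induct)
    case (subspace r)
    show ?case
      by (rule subspaceI)
         (auto simp: nprod_left.zero nprod_left.add nprod_left.scale intro: E_zero E_add E_scale)
  next
    case (nonpos r x)
    then show ?case by (auto intro: nprod_any_in_E)
  next
    case (step r u k x)
    have "nprod u (-1 - int k - int i) (nprod x (n + int i) y) \<in> E (r + int k + s + shift n)" for i
      by (rule nprod_any_in_E[OF step.IH[OF step.prems]]) (auto simp: shift_def)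
    moreover have "nprod x (n + (-1 - int k) - int i) (nprod u (int i) y)
        \<in> E (r + int k + s + shift n)" for i
      by (rule E_mono[OF step.IH, where s1 = "s - int i"])
         (auto simp: shift_def intro: nprod_nonneg_in_E step.prems)
    ultimately show ?case
      unfolding iterate_formula[of u "-1 - int k"]
      by (intro subspace_Sum_any subspace_E E_scale E_diff)
  next
    case (mono m n x)
    then show ?case by (meson E_mono add_right_mono)
  qed
  then show ?thesis using assms(3) E_mono by blast
qed

section \<open>Commutativity and associativity of the (-1)-product modulo higher filtration\<close>

lemma nprod_left_commute:
  assumes "a \<in> E r" "b \<in> E s" "c \<in> E t" "n \<le> r + s + t + 1"
  shows "nprod a (-1) (nprod b (-1) c) - nprod b (-1) (nprod a (-1) c) \<in> E n"
proof -
  \<comment> \<open>In each commutator term the mode i >= 0 costs only i degrees, while the mode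
    -2-i regains i + 1. The surplus of one is what puts the commutator in the next filtration
    step.\<close>
  have "nprod (nprod a (int i) b) (-1 + -1 - int i) c \<in> E n" for i
  proof (rule nprod_E_E[OF nprod_E_E[OF assms(1,2)] assms(3)])
    show "r + s - int i \<le> r + s + shift (int i)" by (simp add: shift_def)
    show "n \<le> r + s - int i + t + shift (-1 + -1 - int i)" using assms(4) by (simp add: shift_def)
  qed
  then show ?thesis
    unfolding commutator_formula by (intro subspace_Sum_any subspace_E E_scale)
qed

text \<open>At \<open>l = -1\<close> the coefficients (-1)^i binom(-1, i) are all 1, and (-1)^(-1) =
  -1 turns the difference into a sum. Finiteness of the support, from truncation, allows single
  terms to be split off.\<close>

lemma iterate_minus_one:
  "nprod (nprod a (-1) b) n c =
     Sum_any (\<lambda>i::nat. nprod a (-1 - int i) (nprod b (n + int i) c) + nprod b (n - 1 - int i) (nprod a (int i) c))"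
  (is ?formula)
  and finite_iterate_minus_one:
  "finite {i. nprod a (-1 - int i) (nprod b (n + int i) c) + nprod b (n - 1 - int i) (nprod a (int i) c) \<noteq> 0}"
proof -
  have "(-1) ^ i * (- 1 gchoose i) = (1::complex)" for i
    by (simp add: gbinomial_minus_one flip: power_mult_distrib)
  then show ?formula
    unfolding iterate_formula[of a "-1" b n c] by simp
next
  obtain M N where "\<forall>k\<ge>M. nprod b k c = 0" "\<forall>k\<ge>N. nprod a k c = 0"
    using truncation by metis
  then show "finite {i. nprod a (-1 - int i) (nprod b (n + int i) c) + nprod b (n - 1 - int i) (nprod a (int i) c) \<noteq> 0}"
    by (intro finite_subset[OF _ finite_lessThan[of "nat (M - n) + nat N"]] subsetI)
       (auto simp: nprod_right.zero intro: ccontr)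
qed

lemma nprod_assoc:
  assumes "a \<in> E r" "b \<in> E s" "c \<in> E t" "n \<le> r + s + t + 1"
  shows "nprod (nprod a (-1) b) (-1) c - nprod a (-1) (nprod b (-1) c) \<in> E n"
proof -
  let ?f = "\<lambda>i::nat. nprod a (-1 - int i) (nprod b (-1 + int i) c)"
  let ?g = "\<lambda>i::nat. nprod b (-1 - 1 - int i) (nprod a (int i) c)"
  \<comment> \<open>Index 0 is inserted so that its term can be removed from the sum even when it
    vanishes.\<close>
  let ?I = "insert 0 {i. ?f i + ?g i \<noteq> 0}"
  note fin = finite_iterate_minus_one[of a b "-1" c]
  \<comment> \<open>For \<open>i\<close> at least 1 the inner mode i - 1 is nonnegative and
    therefore yields the extra degree; only \<open>?f 0\<close>, the reassociated product itself,
    lacks it.\<close>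
  have f: "?f i \<in> E n" if "i \<noteq> 0" for i
  proof (rule nprod_E_E[OF assms(1) nprod_E_E[OF assms(2,3) order_refl]])
    show "n \<le> r + (s + t + shift (- 1 + int i)) + shift (- 1 - int i)"
      using assms(4) that by (simp add: shift_def)
  qed
  have g: "?g i \<in> E n" for i
  proof (rule nprod_E_E[OF assms(2) nprod_E_E[OF assms(1,3) order_refl]])
    show "n \<le> s + (r + t + shift (int i)) + shift (- 1 - 1 - int i)"
      using assms(4) by (simp add: shift_def)
  qed
  have "nprod (nprod a (-1) b) (-1) c = (\<Sum>i\<in>?I. ?f i + ?g i)"
    unfolding iterate_minus_one by (intro Sum_any.expand_superset finite.insertI fin) auto
  also have "\<dots> = ?f 0 + ?g 0 + (\<Sum>i\<in>?I - {0}. ?f i + ?g i)"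
    by (intro sum.remove finite.insertI fin) auto
  finally have "nprod (nprod a (-1) b) (-1) c - nprod a (-1) (nprod b (-1) c) =
      ?g 0 + (\<Sum>i\<in>?I - {0}. ?f i + ?g i)"
    by simp
  also have "\<dots> \<in> E n"
    using f g g[of 0] by (intro E_add subspace_sum[OF subspace_E]) auto
  finally show ?thesis .
qed

section \<open>The derivation D and its divided powers\<close>

lemma D_linear: "Vector_Spaces.linear scale scale D"
  unfolding D_def by (rule linear_left)

sublocale D: Vector_Spaces.linear scale scale D
  by (rule D_linear)

lemma D_in_E: "x \<in> E n \<Longrightarrow> D x \<in> E (n + 1)"
  unfolding D_def by (rule nprod_E_E[where s = 0]) (auto simp: E_nonpos shift_def)

text \<open>In the iterate formula for u_{-2} vac the vacuum modes leave only \<open>i = k\<close>,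
  with coefficient (-1)^k binom(-2, k) = k + 1.\<close>

lemma nprod_D: "nprod (D u) (-1 - int k) w = scale (of_nat (Suc k)) (nprod u (-2 - int k) w)"
proof -
  have "nprod (D u) (-1 - int k) w =
    Sum_any (\<lambda>i::nat. scale ((-1) ^ i * (of_int (-2) gchoose i)) (nprod u (-2 - int i) (nprod vac (-1 - int k + int i) w)))"
    unfolding D_def iterate_formula[of u "-2"] by (simp add: vacuum)
  also have "\<dots> = scale ((-1) ^ k * (of_int (-2) gchoose k)) (nprod u (-2 - int k) (nprod vac (-1 - int k + int k) w))"
    by (rule Sum_any_single) (simp add: vacuum nprod_right.zero)
  also have "(-1) ^ k * (of_int (-2) gchoose k) = (of_nat (Suc k) :: complex)"
    by (simp add: gbinomial_minus_two flip: power_mult_distrib mult.assoc)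
  finally show ?thesis by (simp add: vacuum)
qed

text \<open>Apply the iterate formula to \<open>vac\<close>: creation kills all terms except
  \<open>i = 0\<close> and \<open>i = 1\<close>, which are a_{-1}(D b) and a_{-2} b = (D a)_{-1} b.
  The rule holds exactly, not merely modulo higher filtration.\<close>

lemma D_nprod: "D (nprod a (-1) b) = nprod (D a) (-1) b + nprod a (-1) (D b)"
proof -
  let ?f = "\<lambda>i::nat. nprod a (-1 - int i) (nprod b (-2 + int i) vac)"
  have "?f i = 0" if "i \<notin> {0, 1}" for i
    using that by (simp add: creation nprod_right.zero)
  then have "Sum_any ?f = sum ?f {0, 1}"
    by (intro Sum_any.expand_superset) auto
  then have "D (nprod a (-1) b) = nprod a (-2) b + nprod a (-1) (D b)"
    by (simp add: D_def iterate_minus_one creation nprod_right.zero)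
  then show ?thesis
    using nprod_D[of a 0 b] by simp
qed

lemma funpow_D_in_E: "x \<in> E n \<Longrightarrow> (D ^^ k) x \<in> E (n + int k)"
  by (induction k) (use D_in_E in \<open>fastforce simp: add_ac\<close>)+

lemma nprod_funpow_D:
  "nprod ((D ^^ k) u) (-1) w = scale (fact k) (nprod u (-1 - int k) w)"
proof -
  \<comment> \<open>Each D moved off \<open>u\<close> lowers the mode by one, so the induction needs
    an arbitrary starting mode -1-j. The factor \<open>fact j\<close> avoids a quotient of
    factorials.\<close>
  have "scale (fact j) (nprod ((D ^^ k) u) (-1 - int j) w) =
      scale (fact (j + k)) (nprod u (-1 - int (j + k)) w)" for j
  proof (induction k arbitrary: j)
    case (Suc k)
    have "nprod ((D ^^ Suc k) u) (-1 - int j) w =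
        scale (of_nat (Suc j)) (nprod ((D ^^ k) u) (-1 - int (Suc j)) w)"
      by (simp add: nprod_D)
    then show ?case
      using Suc.IH[of "Suc j"] by (simp add: algebra_simps)
  qed simp
  from this[of 0] show ?thesis by simp
qed

lemma funpow_D_nprod:
  "(D ^^ n) (nprod a (-1) b) =
     (\<Sum>i\<le>n. scale (of_nat (n choose i)) (nprod ((D ^^ i) a) (-1) ((D ^^ (n - i)) b)))"
proof (induction n)
  case (Suc n)
  define F where "F i j = nprod ((D ^^ i) a) (-1) ((D ^^ j) b)" for i j
  have "(D ^^ Suc n) (nprod a (-1) b) =
      (\<Sum>i\<le>n. scale (of_nat (n choose i)) (F (Suc i) (n - i) + F i (Suc (n - i))))"
    by (simp add: Suc.IH D.sum D.scale D_nprod F_def)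
  \<comment> \<open>The second sum may run to \<open>Suc n\<close> because
    \<open>n choose Suc n\<close> is 0; both sums then match Pascal's rule.\<close>
  also have "\<dots> = (\<Sum>i\<le>n. scale (of_nat (n choose i)) (F (Suc i) (n - i)))
      + (\<Sum>i\<le>Suc n. scale (of_nat (n choose i)) (F i (Suc n - i)))"
    by (simp add: scale_right_distrib sum.distrib Suc_diff_le cong: sum.cong_simp)
  also have "\<dots> = (\<Sum>i\<le>Suc n. scale (of_nat (Suc n choose i)) (F i (Suc n - i)))"
    by (simp only: sum.atMost_Suc_shift[of _ n] binomial_Suc_Suc of_nat_add scale_left_distrib
        sum.distrib diff_Suc_Suc) simp
  finally show ?case by (simp add: F_def)
qed simp

section \<open>Strictly decreasing derivative orders\<close>

text \<open>A representative in V of \<open>gr_monomial\<close>, so that relations in the graded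
  algebra become congruences between vectors modulo \<open>E\<close> at weight plus one.\<close>

definition monomial :: "(nat \<times> 'v) list \<Rightarrow> 'v" where
  "monomial kvs = foldr (\<lambda>(k, v) x. nprod ((D ^^ k) v) (-1) x) kvs vac"

abbreviation weight :: "(nat \<times> 'v) list \<Rightarrow> nat" where
  "weight kvs \<equiv> sum_list (map fst kvs)"

lemma monomial_simps [simp]:
  "monomial [] = vac"
  "monomial ((k, v) # kvs) = nprod ((D ^^ k) v) (-1) (monomial kvs)"
  by (simp_all add: monomial_def)

lemma funpow_D_in_E_weight: "(D ^^ k) v \<in> E (int k)"
  using funpow_D_in_E[of v 0 k] by (simp add: E_nonpos)

lemma monomial_in_E: "monomial kvs \<in> E (int (weight kvs))"
proof (induction kvs)
  case (Cons kv kvs)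
  then show ?case
    by (cases kv) (auto intro: nprod_E_E funpow_D_in_E_weight simp: shift_def)
qed (simp add: E_nonpos)

text \<open>Left multiplication by D^k v raises the filtration degree of the error by k, the same
  amount by which the weight grows.\<close>

lemma monomial_Cons_cong:
  assumes "monomial xs - monomial ys \<in> E (int n + 1)"
  shows "monomial (x # xs) - monomial (x # ys) \<in> E (int (fst x + n) + 1)"
proof -
  have "nprod ((D ^^ fst x) (snd x)) (-1) (monomial xs - monomial ys) \<in> E (int (fst x + n) + 1)"
    by (rule nprod_E_E[OF funpow_D_in_E_weight assms]) (simp add: shift_def)
  then show ?thesis
    by (cases x) (simp add: nprod_right.diff)
qed

text \<open>Since monomials end in \<open>vac\<close>, every entry, including the last, acts by left
  multiplication; commuting left multiplications is all that reordering requires.\<close>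

lemma monomial_swap:
  "monomial (x # y # xs) - monomial (y # x # xs) \<in> E (int (weight (x # y # xs)) + 1)"
  by (cases x; cases y)
     (auto intro: nprod_left_commute funpow_D_in_E_weight monomial_in_E)

lemma monomial_move_to_front:
  "monomial (xs @ y # ys) - monomial (y # xs @ ys) \<in> E (int (weight (xs @ y # ys)) + 1)"
proof (induction xs)
  case Nil
  then show ?case by (simp add: E_zero)
next
  case (Cons x xs)
  from E_add[OF monomial_Cons_cong[OF this, of x] E_mono[OF monomial_swap[of x y "xs @ ys"]]]
  show ?case by (simp add: add_ac)
qed

lemma monomial_permute:
  assumes "mset xs = mset ys"
  shows "monomial xs - monomial ys \<in> E (int (weight xs) + 1)"
  using assms
proof (induction xs arbitrary: ys)
  case Nil
  then show ?case by (simp add: E_zero)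
next
  case (Cons x xs)
  then have "x \<in> set ys"
    by (metis list.set_intros(1) set_mset_mset)
  then obtain ys1 ys2 where ys: "ys = ys1 @ x # ys2"
    by (meson split_list)
  with Cons have *: "monomial xs - monomial (ys1 @ ys2) \<in> E (int (weight xs) + 1)"
    by simp
  have "weight (x # xs) = weight ys"
    using Cons.prems by (metis mset_map sum_mset_sum_list)
  with monomial_move_to_front[of ys1 x ys2]
  have "monomial ys - monomial (x # ys1 @ ys2) \<in> E (int (weight (x # xs)) + 1)"
    by (simp add: ys add_ac)
  from E_diff[OF monomial_Cons_cong[OF *, of x] E_mono[OF this]] show ?case
    by simp
qed

text \<open>Adjoining \<open>E (int n + 1)\<close> makes membership mean that the class in degree
  \<open>n\<close> is a combination of strictly decreasing monomials of weight exactly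
  \<open>n\<close>.\<close>

definition strict_span :: "nat \<Rightarrow> 'v set" where
  "strict_span n = span ({monomial kvs | kvs. kvs \<noteq> [] \<and> sorted_wrt (>) (map fst kvs) \<and> weight kvs = n}
     \<union> E (int n + 1))"

lemma subspace_strict_span: "subspace (strict_span n)"
  by (simp add: strict_span_def)

lemma E_Suc_in_strict_span: "x \<in> E (int n + 1) \<Longrightarrow> x \<in> strict_span n"
  by (auto simp: strict_span_def intro: span_base)

lemma strict_span_cong:
  assumes "x - y \<in> E (int n + 1)" "y \<in> strict_span n"
  shows "x \<in> strict_span n"
  using subspace_add[OF subspace_strict_span E_Suc_in_strict_span[OF assms(1)] assms(2)] by simp

text \<open>Distinct orders become strictly decreasing after sorting, and the permutation costs only
  an element of the next filtration step.\<close>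

lemma monomial_in_strict_span_if_distinct:
  assumes "kvs \<noteq> []" "distinct (map fst kvs)"
  shows "monomial kvs \<in> strict_span (weight kvs)"
proof -
  define xs where "xs = rev (sort_key fst kvs)"
  have mset: "mset xs = mset kvs"
    by (simp add: xs_def)
  then have "mset (map fst xs) = mset (map fst kvs)"
    by simp
  then have "distinct (map fst xs)" "weight xs = weight kvs"
    using assms(2) by (metis mset_eq_imp_distinct_iff, metis sum_mset_sum_list)
  then have "sorted_wrt (>) (map fst xs)"
    by (simp add: xs_def rev_map[symmetric] sorted_wrt_rev strict_sorted_iff)
  moreover have "xs \<noteq> []"
    using assms(1) mset by auto
  ultimately have "monomial xs \<in> strict_span (weight kvs)"
    unfolding strict_span_def using \<open>weight xs = weight kvs\<close> by (intro span_base) blast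
  then show ?thesis
    using monomial_permute[of kvs xs] mset by (auto intro: strict_span_cong)
qed

text \<open>
  Leibniz' rule for $\partial^{2k}(ab)$ solved for its middle term.
\<close>

lemma monomial_collision:
  "scale (of_nat ((2 * k) choose k)) (monomial ((k, a) # (k, b) # kvs))
   - (monomial ((2 * k, nprod a (-1) b) # kvs)
      - (\<Sum>i\<in>{..2 * k} - {k}. scale (of_nat ((2 * k) choose i)) (monomial ((i, a) # (2 * k - i, b) # kvs))))
   \<in> E (int (2 * k + weight kvs) + 1)"
proof -
  let ?c = "\<lambda>i. of_nat ((2 * k) choose i) :: complex"
  let ?w = "monomial kvs"
  \<comment> \<open>Leibniz' rule yields products grouped as (D^i a D^(2k-i) b) w; reassociating
    each into a monomial is free modulo the next filtration step.\<close>
  have "nprod (nprod ((D ^^ i) a) (-1) ((D ^^ (2 * k - i)) b)) (-1) ?w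
      - monomial ((i, a) # (2 * k - i, b) # kvs) \<in> E (int (2 * k + weight kvs) + 1)"
    if "i \<le> 2 * k" for i
    unfolding monomial_simps
    by (rule nprod_assoc[OF funpow_D_in_E_weight funpow_D_in_E_weight monomial_in_E]) (use that in auto)
  then have "(\<Sum>i\<le>2 * k. scale (?c i) (nprod (nprod ((D ^^ i) a) (-1) ((D ^^ (2 * k - i)) b)) (-1) ?w
      - monomial ((i, a) # (2 * k - i, b) # kvs))) \<in> E (int (2 * k + weight kvs) + 1)"
    by (intro subspace_sum subspace_E E_scale) auto
  also have "(\<Sum>i\<le>2 * k. scale (?c i) (nprod (nprod ((D ^^ i) a) (-1) ((D ^^ (2 * k - i)) b)) (-1) ?w
      - monomial ((i, a) # (2 * k - i, b) # kvs))) =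
     monomial ((2 * k, nprod a (-1) b) # kvs)
       - (\<Sum>i\<le>2 * k. scale (?c i) (monomial ((i, a) # (2 * k - i, b) # kvs)))"
    by (simp add: funpow_D_nprod nprod_left.sum nprod_left.scale scale_right_diff_distrib sum_subtractf)
  also have "(\<Sum>i\<le>2 * k. scale (?c i) (monomial ((i, a) # (2 * k - i, b) # kvs))) =
     scale (?c k) (monomial ((k, a) # (k, b) # kvs))
      + (\<Sum>i\<in>{..2 * k} - {k}. scale (?c i) (monomial ((i, a) # (2 * k - i, b) # kvs)))"
    by (subst sum.remove[where x = k]) (auto simp: mult_2)
  finally have "- (monomial ((2 * k, nprod a (-1) b) # kvs)
       - (scale (?c k) (monomial ((k, a) # (k, b) # kvs))
      + (\<Sum>i\<in>{..2 * k} - {k}. scale (?c i) (monomial ((i, a) # (2 * k - i, b) # kvs)))))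
       \<in> E (int (2 * k + weight kvs) + 1)"
    by (rule subspace_neg[OF subspace_E])
  then show ?thesis
    by (simp add: algebra_simps)
qed

lemma monomial_in_strict_span:
  assumes "kvs \<noteq> []"
  shows "monomial kvs \<in> strict_span (weight kvs)"
  using assms
  \<comment> \<open>For fixed weight, spreading $(k,k)$ to $(i,2k-i)$ increases the sum of squares; replacing
    $(k,k)$ by $(2k)$ shortens the list and does not decrease it. The sum of squares is at most
    the square of the weight.\<close>
proof (induction "length kvs + (weight kvs)\<^sup>2 - (\<Sum>k\<leftarrow>map fst kvs. k\<^sup>2)" arbitrary: kvs rule: less_induct)
  case less
  show ?case
  proof (cases "distinct (map fst kvs)")
    case True
    then show ?thesis using less.prems monomial_in_strict_span_if_distinct by blast
  next
    case False
    then obtain k a b rest where mset: "mset kvs = mset ((k, a) # (k, b) # rest)" (is "_ = mset ?xs")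
      by (rule not_distinct_map_fst_mset)
    note sum_list_mset_cong[OF this]
    from this[of fst] this[of "\<lambda>kv. (fst kv)\<^sup>2"]
    have sums: "weight kvs = 2 * k + weight rest"
      "(\<Sum>k\<leftarrow>map fst kvs. k\<^sup>2) = 2 * k\<^sup>2 + (\<Sum>k\<leftarrow>map fst rest. k\<^sup>2)"
      by (simp_all add: comp_def)
    have "length kvs = length rest + 2"
      using mset by (metis add_2_eq_Suc' length_Cons size_mset)
    \<comment> \<open>Subtraction on \<open>nat\<close> truncates; the bound on the sums of squares
      ensures that it does not do so here.\<close>
    have smaller: "length ys + (weight ys)\<^sup>2 - (\<Sum>k\<leftarrow>map fst ys. k\<^sup>2)
        < length kvs + (weight kvs)\<^sup>2 - (\<Sum>k\<leftarrow>map fst kvs. k\<^sup>2)"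
      if "weight ys = weight kvs" "length ys + (\<Sum>k\<leftarrow>map fst kvs. k\<^sup>2) < length kvs + (\<Sum>k\<leftarrow>map fst ys. k\<^sup>2)"
      for ys
      using that(2) sum_squares_le_square_sum[of "map fst kvs"] sum_squares_le_square_sum[of "map fst ys"]
      unfolding that(1) by linarith
    have "monomial ((2 * k, nprod a (-1) b) # rest) \<in> strict_span (weight kvs)"
      using less.hyps[OF smaller, of "(2 * k, nprod a (-1) b) # rest"] sums \<open>length kvs = _\<close>
      by (simp add: power_mult_distrib)
    moreover have "monomial ((i, a) # (2 * k - i, b) # rest) \<in> strict_span (weight kvs)"
      if "i \<in> {..2 * k} - {k}" for i
    proof -
      define j where "j = 2 * k - i"
      have "2 * k = i + j" "i \<noteq> j"
        using that by (auto simp: j_def)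
      \<comment> \<open>With i + j = 2k, the sum of squares i^2 + j^2 exceeds 2k^2 by (i - j)^2 / 2.
        The computation is in \<open>int\<close> so that the difference is a true one.\<close>
      have "0 < (int i - int j)\<^sup>2"
        using \<open>i \<noteq> j\<close> by simp
      also have "\<dots> = 2 * (int i)\<^sup>2 + 2 * (int j)\<^sup>2 - (int i + int j)\<^sup>2"
        by (simp add: power2_eq_square algebra_simps)
      also have "(int i + int j)\<^sup>2 = 4 * (int k)\<^sup>2"
        using arg_cong[OF \<open>2 * k = i + j\<close>, of "\<lambda>m. (int m)\<^sup>2"] by (simp add: power_mult_distrib)
      finally have "int (2 * k\<^sup>2) < int (i\<^sup>2 + (2 * k - i)\<^sup>2)"
        using \<open>2 * k = i + j\<close> by simp
      then have "2 * k\<^sup>2 < i\<^sup>2 + (2 * k - i)\<^sup>2"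
        by (simp only: of_nat_less_iff)
      then show ?thesis
        using less.hyps[OF smaller, of "(i, a) # (2 * k - i, b) # rest"] sums \<open>length kvs = _\<close> that
        by simp
    qed
    ultimately have "monomial ((2 * k, nprod a (-1) b) # rest)
        - (\<Sum>i\<in>{..2 * k} - {k}. scale (of_nat ((2 * k) choose i)) (monomial ((i, a) # (2 * k - i, b) # rest)))
        \<in> strict_span (weight kvs)"
      by (intro subspace_diff subspace_strict_span subspace_sum subspace_scale)
    then have "scale (of_nat ((2 * k) choose k)) (monomial ?xs) \<in> strict_span (weight kvs)"
      using monomial_collision[of k a b rest] unfolding sums(1)[symmetric] by (rule strict_span_cong[rotated])
    \<comment> \<open>The central binomial coefficient is nonzero in characteristic 0 and can be
      divided out.\<close>
    from subspace_scale[OF subspace_strict_span this, of "1 / of_nat ((2 * k) choose k)"]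
    have "monomial ?xs \<in> strict_span (weight kvs)"
      by simp
    then show ?thesis
      using monomial_permute[OF mset] strict_span_cong by blast
  qed
qed

lemma E_in_strict_span:
  assumes "x \<in> E (int n)"
  shows "x \<in> strict_span n"
proof -
  have *: "foldr (\<lambda>(u, k) w. nprod u (-1 - int k) w) us v \<in> strict_span n"
    if "int (sum_list (map snd us)) \<ge> int n" for us v
  proof (cases "sum_list (map snd us) = n")
    case True
    \<comment> \<open>The innermost vector is v_{-1} vac, whence the final entry of order 0, which
      also makes the list nonempty. Each mode contributes 1/k! by
      \<open>nprod_funpow_D\<close>.\<close>
    let ?kvs = "map (\<lambda>(u, k). (k, u)) us @ [(0, v)]"
    have "foldr (\<lambda>(u, k) w. nprod u (-1 - int k) w) us v =
      scale (1 / prod_list (map (\<lambda>(u, k). fact k) us)) (monomial ?kvs)"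
    proof (induction us)
      case (Cons uk us)
      then show ?case by (cases uk) (simp add: nprod_funpow_D nprod_right.scale)
    qed (simp add: creation)
    moreover have "weight ?kvs = n"
      using True by (simp add: case_prod_beta' comp_def)
    ultimately show ?thesis
      using monomial_in_strict_span[of ?kvs] subspace_scale[OF subspace_strict_span] by auto
  next
    case False
    \<comment> \<open>A word of weight above \<open>n\<close> already lies in
      \<open>E (int n + 1)\<close>.\<close>
    have "foldr (\<lambda>(u, k) w. nprod u (-1 - int k) w) us v \<in> E (int (sum_list (map snd us)))"
    proof (induction us)
      case (Cons uk us)
      then show ?case
        by (cases uk) (use nprod_in_E in \<open>fastforce simp: add.commute\<close>)
    qed (simp add: E_nonpos)
    then show ?thesis
      using False that by (intro E_Suc_in_strict_span) (auto intro: E_mono)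
  qed
  show ?thesis
    using assms unfolding E_def
    by (rule span_induct) (use * subspace_strict_span in auto)
qed

section \<open>The associated graded algebra\<close>

definition coset :: "nat \<Rightarrow> 'v \<Rightarrow> 'v set" where
  "coset n a = a +o E (int n + 1)"

definition class_seq :: "(nat \<Rightarrow> 'v) \<Rightarrow> nat \<Rightarrow> 'v set" where
  "class_seq x = (\<lambda>n. coset n (x n))"

text \<open>Finitely supported sequences of representatives, through which all operations of
  \<open>gr\<close> are computed; \<open>class_seq\<close> is not injective on them.\<close>

definition graded :: "(nat \<Rightarrow> 'v) set" where
  "graded = {x. (\<forall>n. x n \<in> E (int n)) \<and> finite {n. x n \<noteq> 0}}"

definition homog :: "nat \<Rightarrow> 'v \<Rightarrow> nat \<Rightarrow> 'v" where
  "homog n a = (\<lambda>m. if m = n then a else 0)"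

lemma mem_coset: "b \<in> coset n a \<longleftrightarrow> b - a \<in> E (int n + 1)"
  by (simp add: coset_def set_minus_plus)

lemma self_in_coset: "a \<in> coset n a"
  by (simp add: mem_coset E_zero)

lemma coset_0: "coset n 0 = E (int n + 1)"
  by (simp add: coset_def)

lemma coset_eq_iff: "coset n a = coset n b \<longleftrightarrow> a - b \<in> E (int n + 1)"
proof
  assume "coset n a = coset n b"
  then show "a - b \<in> E (int n + 1)"
    using self_in_coset[of a n] by (simp add: mem_coset)
next
  assume *: "a - b \<in> E (int n + 1)"
  have "c - a \<in> E (int n + 1) \<longleftrightarrow> c - b \<in> E (int n + 1)" for c
    using E_add[OF _ *, of "c - a"] E_diff[OF _ *, of "c - b"] by auto
  then show "coset n a = coset n b"
    by (auto simp: mem_coset)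
qed

lemma coset_add: "coset n a + coset n b = coset n (a + b)"
proof -
  have "E (int n + 1) + E (int n + 1) = E (int n + 1)"
    using E_zero by (fastforce elim!: set_plus_elim intro: E_add set_zero_plus2[THEN subsetD])
  then show ?thesis
    by (simp add: coset_def set_plus_rearrange)
qed

lemma sum_coset:
  assumes "finite I" "I \<noteq> {}"
  shows "(\<Sum>i\<in>I. coset n (f i)) = coset n (\<Sum>i\<in>I. f i)"
  using assms by (induction I rule: finite_ne_induct) (auto simp: coset_add)

text \<open>Reduces the operations of \<open>gr\<close>, defined as unions over all representatives,
  to independence of the representative.\<close>

lemma UN_coset_const:
  assumes "\<And>b. b \<in> coset n a \<Longrightarrow> f b = f a"
  shows "(\<Union>b\<in>coset n a. f b) = f a"
  using assms self_in_coset by blast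

lemma quot_E: "quot (E (int n)) (E (int n + 1)) = coset n ` E (int n)"
  by (simp add: quot_def coset_def)

lemma carrier_gr: "carrier gr = class_seq ` graded"
proof
  show "carrier gr \<subseteq> class_seq ` graded"
  proof
    fix f assume "f \<in> carrier gr"
    then have f: "f n \<in> coset n ` E (int n)" "finite {n. f n \<noteq> E (int n + 1)}" for n
      by (simp_all add: gr_def quot_E)
    \<comment> \<open>The zero coset is given the representative 0, so that finite support passes
      from cosets to representatives.\<close>
    then have "\<exists>a\<in>E (int n). f n = coset n a \<and> (f n = E (int n + 1) \<longrightarrow> a = 0)" for n
      by (cases "f n = E (int n + 1)") (use E_zero coset_0 in blast)+
    then obtain x where x: "\<And>n. x n \<in> E (int n)" "\<And>n. f n = coset n (x n)"
      "\<And>n. f n = E (int n + 1) \<longrightarrow> x n = 0"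
      by metis
    have "{n. x n \<noteq> 0} \<subseteq> {n. f n \<noteq> E (int n + 1)}"
      using x(3) by auto
    then have "x \<in> graded"
      using x(1) f(2) by (auto simp: graded_def intro: finite_subset)
    moreover have "f = class_seq x"
      using x(2) by (auto simp: class_seq_def)
    ultimately show "f \<in> class_seq ` graded" by blast
  qed
next
  have "{n. coset n (x n) \<noteq> E (int n + 1)} \<subseteq> {n. x n \<noteq> 0}" for x
    using coset_0 by auto
  then show "class_seq ` graded \<subseteq> carrier gr"
    by (auto simp: gr_def quot_E class_seq_def graded_def intro: finite_subset)
qed

lemma gr_zero: "\<zero>\<^bsub>gr\<^esub> = class_seq (\<lambda>_. 0)"
  by (simp add: gr_def class_seq_def coset_0)

lemma gr_one: "\<one>\<^bsub>gr\<^esub> = class_seq (homog 0 vac)"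
  by (simp add: gr_def class_seq_def homog_def coset_def fun_eq_iff)

lemma gr_add: "class_seq x \<oplus>\<^bsub>gr\<^esub> class_seq y = class_seq (\<lambda>n. x n + y n)"
  by (simp add: gr_def class_seq_def coset_add)

lemma gr_smult: "c \<odot>\<^bsub>gr\<^esub> class_seq x = class_seq (\<lambda>n. scale c (x n))"
proof -
  have "(\<Union>a\<in>coset n (x n). coset n (scale c a)) = coset n (scale c (x n))" for n
    by (rule UN_coset_const)
       (simp add: mem_coset coset_eq_iff E_scale flip: scale_right_diff_distrib)
  then show ?thesis
    by (simp add: gr_def class_seq_def coset_def)
qed

lemma gr_deriv: "deriv gr (class_seq x) = class_seq (\<lambda>n. case n of 0 \<Rightarrow> 0 | Suc m \<Rightarrow> D (x m))"
proof
  fix n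
  have "(\<Union>a\<in>coset m (x m). coset (Suc m) (D a)) = coset (Suc m) (D (x m))" for m
  proof (rule UN_coset_const)
    fix a assume "a \<in> coset m (x m)"
    then have "D (a - x m) \<in> E (int m + 1 + 1)"
      by (intro D_in_E) (simp add: mem_coset)
    then show "coset (Suc m) (D a) = coset (Suc m) (D (x m))"
      by (simp add: coset_eq_iff D.diff add_ac)
  qed
  then show "deriv gr (class_seq x) n = class_seq (\<lambda>n. case n of 0 \<Rightarrow> 0 | Suc m \<Rightarrow> D (x m)) n"
    by (cases n) (simp_all add: gr_def class_seq_def coset_def add_ac)
qed

text \<open>Changing one factor by an element one step higher moves a_{-1}b by an element of
  \<open>E (int n + 1)\<close>, provided the other factor lies in its own filtration step;
  \<open>graded\<close> supplies this.\<close>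

lemma gr_mult:
  assumes "x \<in> graded" "y \<in> graded"
  shows "class_seq x \<otimes>\<^bsub>gr\<^esub> class_seq y = class_seq (\<lambda>n. \<Sum>i\<le>n. nprod (x i) (-1) (y (n - i)))"
proof -
  have "(\<Union>a\<in>coset i (x i). \<Union>b\<in>coset (n - i) (y (n - i)). coset n (nprod a (-1) b)) =
      coset n (nprod (x i) (-1) (y (n - i)))" if "i \<le> n" for i n
  proof -
    have xi: "x i \<in> E (int i)" and yi: "y (n - i) \<in> E (int (n - i))"
      using assms by (auto simp: graded_def)
    \<comment> \<open>Proved for arbitrary \<open>a\<close> in \<open>E (int i)\<close>, since the
      inner union is evaluated for every representative of the left coset before \<open>x i\<close>
      is singled out.\<close>
    have right: "(\<Union>b\<in>coset (n - i) (y (n - i)). coset n (nprod a (-1) b)) = coset n (nprod a (-1) (y (n - i)))"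
      if a: "a \<in> E (int i)" for a
    proof (rule UN_coset_const)
      fix b assume "b \<in> coset (n - i) (y (n - i))"
      then have "nprod a (-1) (b - y (n - i)) \<in> E (int n + 1)"
        using \<open>i \<le> n\<close> by (intro nprod_E_E[OF a]) (auto simp: mem_coset shift_def)
      then show "coset n (nprod a (-1) b) = coset n (nprod a (-1) (y (n - i)))"
        by (simp add: coset_eq_iff nprod_right.diff)
    qed
    have a: "a \<in> E (int i)" if "a \<in> coset i (x i)" for a
      using that E_add[OF _ xi, of "a - x i"] E_mono[of "a - x i" "int i + 1" "int i"]
      by (simp add: mem_coset)
    have "(\<Union>a\<in>coset i (x i). coset n (nprod a (-1) (y (n - i)))) = coset n (nprod (x i) (-1) (y (n - i)))"
    proof (rule UN_coset_const)
      fix a assume "a \<in> coset i (x i)"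
      then have "nprod (a - x i) (-1) (y (n - i)) \<in> E (int n + 1)"
        using \<open>i \<le> n\<close> by (intro nprod_E_E[OF _ yi]) (auto simp: mem_coset shift_def)
      then show "coset n (nprod a (-1) (y (n - i))) = coset n (nprod (x i) (-1) (y (n - i)))"
        by (simp add: coset_eq_iff nprod_left.diff)
    qed
    then show ?thesis
      using right a by simp
  qed
  then have "(\<Sum>i\<le>n. \<Union>a\<in>coset i (x i). \<Union>b\<in>coset (n - i) (y (n - i)). coset n (nprod a (-1) b)) =
      coset n (\<Sum>i\<le>n. nprod (x i) (-1) (y (n - i)))" for n
    by (simp add: sum_coset)
  then show ?thesis
    by (simp add: gr_def class_seq_def coset_def)
qed

lemma graded_zero: "(\<lambda>_. 0) \<in> graded"
  by (simp add: graded_def E_zero)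

lemma graded_add:
  assumes "x \<in> graded" "y \<in> graded"
  shows "(\<lambda>n. x n + y n) \<in> graded"
proof -
  have "{n. x n + y n \<noteq> 0} \<subseteq> {n. x n \<noteq> 0} \<union> {n. y n \<noteq> 0}"
    by auto
  from finite_subset[OF this] show ?thesis
    using assms by (simp add: graded_def E_add)
qed

lemma graded_scale:
  assumes "x \<in> graded"
  shows "(\<lambda>n. scale c (x n)) \<in> graded"
proof -
  have "{n. scale c (x n) \<noteq> 0} \<subseteq> {n. x n \<noteq> 0}"
    by auto
  from finite_subset[OF this] show ?thesis
    using assms by (simp add: graded_def E_scale)
qed

lemma graded_D:
  assumes "x \<in> graded"
  shows "(\<lambda>n. case n of 0 \<Rightarrow> 0 | Suc m \<Rightarrow> D (x m)) \<in> graded"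
proof -
  have D_E: "D (x m) \<in> E (int (Suc m))" for m
    using assms D_in_E[of "x m" "int m"] by (simp add: graded_def add_ac)
  have "{n. (case n of 0 \<Rightarrow> 0 | Suc m \<Rightarrow> D (x m)) \<noteq> 0} \<subseteq> Suc ` {n. x n \<noteq> 0}"
  proof
    fix n assume "n \<in> {n. (case n of 0 \<Rightarrow> 0 | Suc m \<Rightarrow> D (x m)) \<noteq> 0}"
    then show "n \<in> Suc ` {n. x n \<noteq> 0}"
      by (cases n) (auto simp: D.zero)
  qed
  moreover have "finite (Suc ` {n. x n \<noteq> 0})"
    using assms by (simp add: graded_def)
  ultimately have "finite {n. (case n of 0 \<Rightarrow> 0 | Suc m \<Rightarrow> D (x m)) \<noteq> 0}"
    by (simp only: finite_subset)
  moreover have "(case n of 0 \<Rightarrow> 0 | Suc m \<Rightarrow> D (x m)) \<in> E (int n)" for n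
    using D_E by (simp add: E_zero split: nat.split)
  ultimately show ?thesis
    unfolding graded_def by blast
qed

lemma graded_mult:
  assumes "x \<in> graded" "y \<in> graded"
  shows "(\<lambda>n. \<Sum>i\<le>n. nprod (x i) (-1) (y (n - i))) \<in> graded"
proof -
  have "{n. (\<Sum>i\<le>n. nprod (x i) (-1) (y (n - i))) \<noteq> 0} \<subseteq>
      (\<lambda>(i, j). i + j) ` ({n. x n \<noteq> 0} \<times> {n. y n \<noteq> 0})"
  proof
    fix n assume "n \<in> {n. (\<Sum>i\<le>n. nprod (x i) (-1) (y (n - i))) \<noteq> 0}"
    then obtain i where "i \<le> n" "nprod (x i) (-1) (y (n - i)) \<noteq> 0"
      by (auto elim: sum.not_neutral_contains_not_neutral)
    then show "n \<in> (\<lambda>(i, j). i + j) ` ({n. x n \<noteq> 0} \<times> {n. y n \<noteq> 0})"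
      by (intro image_eqI[of _ _ "(i, n - i)"]) (auto simp: nprod_left.zero nprod_right.zero)
  qed
  moreover have "(\<Sum>i\<le>n. nprod (x i) (-1) (y (n - i))) \<in> E (int n)" for n
    using assms by (intro subspace_sum subspace_E nprod_E_E) (auto simp: graded_def shift_def)
  moreover have "finite ((\<lambda>(i, j). i + j) ` ({n. x n \<noteq> 0} \<times> {n. y n \<noteq> 0}))"
    using assms by (simp add: graded_def)
  ultimately show ?thesis
    unfolding graded_def using finite_subset by blast
qed

lemma graded_homog: "a \<in> E (int n) \<Longrightarrow> homog n a \<in> graded"
  by (auto simp: graded_def homog_def E_zero)

lemma abelian_monoid_gr: "abelian_monoid gr"
  by (rule abelian_monoidI)
     (auto simp: carrier_gr gr_zero gr_add add_ac intro!: imageI graded_add graded_zero)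

lemma gr_mult_homog:
  assumes "a \<in> E (int r)" "b \<in> E (int s)"
  shows "class_seq (homog r a) \<otimes>\<^bsub>gr\<^esub> class_seq (homog s b) = class_seq (homog (r + s) (nprod a (-1) b))"
proof -
  have "(\<Sum>i\<le>n. nprod (homog r a i) (-1) (homog s b (n - i))) = homog (r + s) (nprod a (-1) b) n" for n
  proof -
    have "(\<Sum>i\<le>n. nprod (homog r a i) (-1) (homog s b (n - i))) =
        (\<Sum>i\<le>n. if i = r then nprod a (-1) (homog s b (n - r)) else 0)"
      by (rule sum.cong) (auto simp: homog_def nprod_left.zero)
    also have "\<dots> = homog (r + s) (nprod a (-1) b) n"
      by (auto simp: homog_def nprod_right.zero)
    finally show ?thesis .
  qed
  then show ?thesis
    by (simp add: gr_mult assms graded_homog)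
qed

lemma gr_deriv_homog: "deriv gr (class_seq (homog n a)) = class_seq (homog (Suc n) (D a))"
  unfolding gr_deriv
  by (rule arg_cong[where f = class_seq]) (auto simp: homog_def D.zero split: nat.splits)

lemma gr_funpow_deriv_homog:
  "(deriv gr ^^ k) (class_seq (homog n a)) = class_seq (homog (n + k) ((D ^^ k) a))"
  by (induction k) (simp_all add: gr_deriv_homog)

lemma in_degree_0_eq: "in_degree_0 (v +o E 1) = class_seq (homog 0 v)"
  by (simp add: in_degree_0_def class_seq_def homog_def coset_def fun_eq_iff)

text \<open>The bridge between the vectors \<open>monomial\<close> and the graded algebra: the
  derivation raises the degree by one and degrees add under products, so the weight is the
  degree.\<close>

lemma gr_monomial_eq: "gr_monomial kvs = class_seq (homog (weight kvs) (monomial kvs))"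
proof (induction kvs)
  case Nil
  then show ?case by (simp add: gr_monomial_def gr_one)
next
  case (Cons kv kvs)
  obtain k v where kv: "kv = (k, v)" by force
  have "gr_monomial (kv # kvs) = (deriv gr ^^ k) (in_degree_0 (v +o E 1)) \<otimes>\<^bsub>gr\<^esub> gr_monomial kvs"
    by (simp add: gr_monomial_def kv)
  also have "\<dots> = class_seq (homog (weight (kv # kvs)) (monomial (kv # kvs)))"
    by (simp add: Cons.IH in_degree_0_eq gr_funpow_deriv_homog gr_mult_homog funpow_D_in_E_weight
        monomial_in_E kv)
  finally show ?case .
qed

section \<open>Spanning and generation in the graded algebra\<close>

lemma gr_monomial_in_carrier: "gr_monomial kvs \<in> carrier gr"
  by (simp add: gr_monomial_eq carrier_gr graded_homog monomial_in_E)

lemma smult_in_carrier: "f \<in> carrier gr \<Longrightarrow> c \<odot>\<^bsub>gr\<^esub> f \<in> carrier gr"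
  by (auto simp: carrier_gr gr_smult graded_scale)

lemma diff_generate_degree_0_subset:
  "diff_generate gr (in_degree_0 ` quot (E 0) (E 1)) \<subseteq> carrier gr"
proof (rule diff_generate_subset_carrier)
  show "in_degree_0 ` quot (E 0) (E 1) \<subseteq> carrier gr"
    by (auto simp: quot_def in_degree_0_eq carrier_gr E_nonpos intro!: imageI graded_homog)
  show "\<one>\<^bsub>gr\<^esub> \<in> carrier gr"
    by (auto simp: gr_one carrier_gr E_nonpos intro!: imageI graded_homog)
next
  fix f g assume "f \<in> carrier gr" "g \<in> carrier gr"
  then show "f \<otimes>\<^bsub>gr\<^esub> g \<in> carrier gr" "f \<oplus>\<^bsub>gr\<^esub> g \<in> carrier gr"
    by (auto simp: carrier_gr gr_add gr_mult intro!: imageI graded_add graded_mult)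
next
  fix f assume "f \<in> carrier gr"
  then show "deriv gr f \<in> carrier gr"
    by (auto simp: carrier_gr gr_deriv intro!: imageI graded_D)
qed (simp_all add: smult_in_carrier, simp add: carrier_gr gr_zero graded_zero)

lemma gr_monomial_in_diff_generate:
  "gr_monomial kvs \<in> diff_generate gr (in_degree_0 ` quot (E 0) (E 1))"
proof -
  have "(deriv gr ^^ k) (in_degree_0 (v +o E 1)) \<in> diff_generate gr (in_degree_0 ` quot (E 0) (E 1))"
    for k v
    by (induction k)
       (auto simp: quot_def E_nonpos intro: diff_generate.base diff_generate.deriv)
  then show ?thesis
    unfolding gr_monomial_def
    by (induction kvs) (auto intro: diff_generate.one diff_generate.mult)
qed

abbreviation strict_monomials :: "(nat \<Rightarrow> 'v set) set" where
  "strict_monomials \<equiv> {gr_monomial kvs | kvs. kvs \<noteq> [] \<and> sorted_wrt (>) (map fst kvs)}"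

lemma lin_span_strict_monomials_add:
  assumes "f \<in> lin_span gr strict_monomials" "g \<in> lin_span gr strict_monomials"
  shows "f \<oplus>\<^bsub>gr\<^esub> g \<in> lin_span gr strict_monomials"
  using abelian_monoid_gr _ _ _ assms
proof (rule lin_span_add)
  fix f c d assume "f \<in> strict_monomials"
  then have "f \<in> carrier gr"
    using gr_monomial_in_carrier by auto
  then show "c \<odot>\<^bsub>gr\<^esub> f \<in> carrier gr" "0 \<odot>\<^bsub>gr\<^esub> f = \<zero>\<^bsub>gr\<^esub>"
    "(c + d) \<odot>\<^bsub>gr\<^esub> f = c \<odot>\<^bsub>gr\<^esub> f \<oplus>\<^bsub>gr\<^esub> d \<odot>\<^bsub>gr\<^esub> f"
    by (auto simp: carrier_gr gr_smult graded_scale gr_add gr_zero scale_left_distrib)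
qed

text \<open>Passing to classes in degree \<open>n\<close> is linear and kills
  \<open>E (int n + 1)\<close>, so \<open>strict_span\<close> maps into the span of the strict
  monomials.\<close>

lemma homog_in_lin_span:
  assumes "a \<in> E (int n)"
  shows "class_seq (homog n a) \<in> lin_span gr strict_monomials"
proof -
  let ?G = "{monomial kvs | kvs. kvs \<noteq> [] \<and> sorted_wrt (>) (map fst kvs) \<and> weight kvs = n}
     \<union> E (int n + 1)"
  have "a \<in> span ?G"
    using E_in_strict_span[OF assms] by (simp add: strict_span_def)
  then show ?thesis
  proof (induction rule: span_induct_alt)
    case base
    show ?case
      using lin_span_zero[OF abelian_monoid_gr] by (simp add: gr_zero homog_def cong: if_cong)
  next
    case (step c x y)
    have "class_seq (homog n (scale c x)) \<in> lin_span gr strict_monomials"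
    proof (cases "x \<in> E (int n + 1)")
      case True
      then have "class_seq (homog n (scale c x)) = \<zero>\<^bsub>gr\<^esub>"
        by (simp add: gr_zero class_seq_def homog_def coset_eq_iff E_scale E_zero fun_eq_iff)
      then show ?thesis
        by (simp add: lin_span_zero[OF abelian_monoid_gr])
    next
      case False
      with step.hyps obtain kvs where kvs: "x = monomial kvs" "weight kvs = n" "gr_monomial kvs \<in> strict_monomials"
        by blast
      then have "class_seq (homog n (scale c x)) = c \<odot>\<^bsub>gr\<^esub> gr_monomial kvs"
        unfolding gr_monomial_eq gr_smult by (intro arg_cong[where f = class_seq]) (auto simp: homog_def)
      then show ?thesis
        using lin_span_smult[OF abelian_monoid_gr kvs(3)] gr_monomial_in_carrier smult_in_carrier by simp
    qed
    from lin_span_strict_monomials_add[OF this step.IH] show ?case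
      unfolding gr_add by (rule back_subst[of "\<lambda>x. x \<in> _"]) (intro arg_cong[where f = class_seq], auto simp: homog_def)
  qed
qed

lemma carrier_gr_subset_lin_span: "carrier gr \<subseteq> lin_span gr strict_monomials"
proof -
  \<comment> \<open>An element of the direct sum is assembled from its homogeneous components by
    induction on a finite set of degrees containing its support.\<close>
  have finite_part: "class_seq (\<lambda>n. if n \<in> N then x n else 0) \<in> lin_span gr strict_monomials"
    if "\<And>n. x n \<in> E (int n)" "finite N" for x N
    using that(2)
  proof induction
    case empty
    then show ?case
      using lin_span_zero[OF abelian_monoid_gr] by (simp add: gr_zero)
  next
    case (insert n N)
    have "class_seq (\<lambda>m. if m \<in> insert n N then x m else 0) =
        class_seq (homog n (x n)) \<oplus>\<^bsub>gr\<^esub> class_seq (\<lambda>m. if m \<in> N then x m else 0)"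
      unfolding gr_add using insert.hyps by (intro arg_cong[where f = class_seq]) (auto simp: homog_def)
    then show ?case
      using lin_span_strict_monomials_add[OF homog_in_lin_span[OF that(1)] insert.IH] by simp
  qed
  have "class_seq x \<in> lin_span gr strict_monomials" if "x \<in> graded" for x
  proof -
    have "(\<lambda>n. if n \<in> {n. x n \<noteq> 0} then x n else 0) = x"
      by auto
    with finite_part[of x "{n. x n \<noteq> 0}"] that show ?thesis
      by (simp add: graded_def)
  qed
  then show ?thesis
    by (auto simp: carrier_gr)
qed

section \<open>Identification of E_1 with C_2\<close>

lemma nprod_in_C2: "k \<ge> 1 \<Longrightarrow> nprod u (-1 - int k) v \<in> C2"
proof -
  assume "k \<ge> 1"
  then obtain j where k: "k = Suc j" by (cases k) auto
  \<comment> \<open>One of the \<open>Suc j\<close> derivatives is used to turn the mode -1 into -2;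
    the factorial is then divided out.\<close>
  have "scale (fact (Suc j)) (nprod u (-1 - int k) v) = nprod (D ((D ^^ j) u)) (-1) v"
    using nprod_funpow_D[of "Suc j" u v] by (simp add: k)
  also have "\<dots> = nprod ((D ^^ j) u) (-2) v"
    using nprod_D[of "(D ^^ j) u" 0 v] by simp
  finally have "nprod u (-1 - int k) v = scale (1 / fact (Suc j)) (nprod ((D ^^ j) u) (-2) v)"
    by (metis scale_scale scale_one fact_nonzero nonzero_divide_eq_eq)
  moreover have "nprod ((D ^^ j) u) (-2) v \<in> C2"
    unfolding C2_def by (blast intro: span_base)
  ultimately show ?thesis
    unfolding C2_def by (simp only: span_scale)
qed

text \<open>Commuting u_{-1} past v_{-2} produces only modes -3-i, which have values in
  \<open>C2\<close>, and what remains is again of the form v_{-2} w'.\<close>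

lemma nprod_minus_one_in_C2:
  assumes "x \<in> C2"
  shows "nprod u (-1) x \<in> C2"
proof -
  have "nprod u (-1) (nprod v (-2) w) \<in> C2" for v w
  proof -
    have "nprod u (-1) (nprod v (-2) w) - nprod v (-2) (nprod u (-1) w) \<in> C2"
      unfolding commutator_formula C2_def
    proof (intro subspace_Sum_any subspace_span span_scale)
      show "nprod (nprod u (int i) v) (- 1 + - 2 - int i) w \<in> span {nprod u (- 2) v |u v. True}" for i
        using nprod_in_C2[of "i + 2" "nprod u (int i) v" w] unfolding C2_def by simp
    qed
    moreover have "nprod v (-2) (nprod u (-1) w) \<in> C2"
      unfolding C2_def by (blast intro: span_base)
    ultimately show ?thesis
      unfolding C2_def using span_add by fastforce
  qed
  then have "nprod u (-1) ` {nprod u (- 2) v |u v. True} \<subseteq> C2"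
    by auto
  then have "nprod u (-1) ` C2 \<subseteq> C2"
    unfolding C2_def nprod_right.span_image[symmetric] by (intro span_minimal) simp_all
  then show ?thesis
    using assms by blast
qed

lemma E_1_eq_C2: "E 1 = C2"
proof
  \<comment> \<open>The implication makes the property vacuous for nonpositive index and stable
    under lowering the index, as \<open>E_induct\<close> demands. In the step, \<open>k = 0\<close>
    keeps the index, so the induction hypothesis applies; larger \<open>k\<close> lands in
    \<open>C2\<close> directly.\<close>
  have "s \<ge> 1 \<longrightarrow> x \<in> C2" if "x \<in> E s" for s x
    using that
  proof (induction rule: E_induct)
    case (subspace n)
    then show ?case
      by (cases "n \<ge> 1") (simp_all add: C2_def)
  next
    case (step n u k x)
    then show ?case
      by (cases "k = 0") (auto intro: nprod_in_C2 nprod_minus_one_in_C2)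
  qed auto
  then show "E 1 \<subseteq> C2" by blast
  show "C2 \<subseteq> E 1"
    unfolding C2_def
    by (rule span_minimal) (auto intro: nprod_neg_in_E[where s = 0] simp: E_nonpos subspace_E)
qed

end

theorem corollary4p3:
  fixes scale :: "complex \<Rightarrow> 'v::ab_group_add \<Rightarrow> 'v"
    and nprod :: "'v \<Rightarrow> int \<Rightarrow> 'v \<Rightarrow> 'v" and vac :: 'v
  assumes "vertex_algebra scale nprod vac"
  shows "carrier (vertex_algebra.gr scale nprod vac) =
           lin_span (vertex_algebra.gr scale nprod vac)
             {vertex_algebra.gr_monomial scale nprod vac kvs | kvs.
                kvs \<noteq> [] \<and> sorted_wrt (>) (map fst kvs)} \<and>
         diff_generate (vertex_algebra.gr scale nprod vac)
           (vertex_algebra.in_degree_0 scale nprod `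
              quot (vertex_algebra.E scale nprod 0) (vertex_algebra.E scale nprod 1)) =
           carrier (vertex_algebra.gr scale nprod vac) \<and>
         quot (vertex_algebra.E scale nprod 0) (vertex_algebra.E scale nprod 1) =
           quot UNIV (vertex_algebra.C2 scale nprod)"
proof -
  interpret vertex_algebra scale nprod vac by fact
  have smult: "c \<odot>\<^bsub>gr\<^esub> f \<in> carrier gr" if "f \<in> strict_monomials" for c f
    using that gr_monomial_in_carrier smult_in_carrier by auto
  \<comment> \<open>The first two equalities follow from a cycle of inclusions: span in generated
    algebra, generated algebra in carrier, carrier in span.\<close>
  have "lin_span gr strict_monomials \<subseteq> diff_generate gr (in_degree_0 ` quot (E 0) (E 1))"
    using gr_monomial_in_diff_generate
    by (intro lin_span_subset_diff_generate abelian_monoid_gr smult) auto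
  then show ?thesis
    using carrier_gr_subset_lin_span diff_generate_degree_0_subset E_nonpos[of 0]
    by (auto simp: E_1_eq_C2)
qed

end
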